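(* Let $\mathcal{P}$ be a finite-dimensional Poisson algebra over an arbitrary field $\mathbb{F}$. Then $\mathcal{P}$ is $\phi$-free if and only if it splits over its zero socle, that is, if and only if there is a subalgebra $C$ of $\mathcal{P}$ such that $\mathcal{P}=Zsoc(\mathcal{P})\dot{+}C$.
   Context: A Poisson algebra $(\mathcal{P},\cdot,[\cdot,\cdot])$ over $\mathbb{F}$ is a vector space with two bilinear products such that $(\mathcal{P},\cdot)$ is a commutative associative algebra (not necessarily unital), $(\mathcal{P},[\cdot,\cdot])$ is a Lie algebra, and $[x\cdot y,z]=[x,z]\cdot y+x\cdot[y,z]$ for all $x,y,z$. A subalgebra is a subspace closed under both products; an ideal is a subspace $I$ with $I\cdot\mathcal{P}+[I,\mathcal{P}]\subseteq I$; a zero ideal is an ideal $I$ with $I\cdot I+[I,I]=0$. A minimal zero ideal is a minimal (nonzero) ideal that is a zero ideal. The zero socle $Zsoc(\mathcal{P})$ is the sum of the minimal zero ideals of $\mathcal{P}$. The Frattini subalgebra $F(\mathcal{P})$ is the intersection of the maximal (proper) subalgebras of $\mathcal{P}$, the Frattini ideal $\phi(\mathcal{P})$ is the largest ideal of $\mathcal{P}$ contained in $F(\mathcal{P})$, and $\mathcal{P}$ is $\phi$-free if $\phi(\mathcal{P})=0$. The symbol $\dot{+}$ denotes a direct sum of underlying vector spaces. *)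

theory Defs
  imports Complex_Main
begin

text \<open>The underlying space of the algebra is the whole type \<open>'v\<close>. The bracket is assumed to be
  alternating rather than merely anticommutative, which matters in characteristic 2.\<close>

locale poisson_algebra = vector_space scale
  for scale :: "'f::field \<Rightarrow> 'v::ab_group_add \<Rightarrow> 'v" (infixr \<open>*s\<close> 75) +
  fixes mul :: "'v \<Rightarrow> 'v \<Rightarrow> 'v" (infixl \<open>\<cdot>\<close> 70)
    and brk :: "'v \<Rightarrow> 'v \<Rightarrow> 'v" (\<open>\<lbrakk>_,_\<rbrakk>\<close>)
  assumes mul_linear_left: "\<And>y. Vector_Spaces.linear scale scale (\<lambda>x. x \<cdot> y)"
    and mul_linear_right: "\<And>x. Vector_Spaces.linear scale scale (\<lambda>y. x \<cdot> y)"
    and mul_assoc: "\<And>x y z. (x \<cdot> y) \<cdot> z = x \<cdot> (y \<cdot> z)"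
    and mul_commute: "\<And>x y. x \<cdot> y = y \<cdot> x"
    and brk_linear_left: "\<And>y. Vector_Spaces.linear scale scale (\<lambda>x. \<lbrakk>x,y\<rbrakk>)"
    and brk_linear_right: "\<And>x. Vector_Spaces.linear scale scale (\<lambda>y. \<lbrakk>x,y\<rbrakk>)"
    and brk_alternating: "\<And>x. \<lbrakk>x,x\<rbrakk> = 0"
    and jacobi: "\<And>x y z. \<lbrakk>x,\<lbrakk>y,z\<rbrakk>\<rbrakk> + \<lbrakk>y,\<lbrakk>z,x\<rbrakk>\<rbrakk> + \<lbrakk>z,\<lbrakk>x,y\<rbrakk>\<rbrakk> = 0"
    and leibniz: "\<And>x y z. \<lbrakk>x \<cdot> y,z\<rbrakk> = \<lbrakk>x,z\<rbrakk> \<cdot> y + x \<cdot> \<lbrakk>y,z\<rbrakk>"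
begin

definition subalgebra :: "'v set \<Rightarrow> bool" where
  "subalgebra S \<longleftrightarrow> subspace S \<and> (\<forall>x\<in>S. \<forall>y\<in>S. x \<cdot> y \<in> S \<and> \<lbrakk>x,y\<rbrakk> \<in> S)"

definition is_ideal :: "'v set \<Rightarrow> bool" where
  "is_ideal I \<longleftrightarrow> subspace I \<and> (\<forall>x\<in>I. \<forall>y. x \<cdot> y \<in> I \<and> \<lbrakk>x,y\<rbrakk> \<in> I)"

definition zero_ideal :: "'v set \<Rightarrow> bool" where
  "zero_ideal I \<longleftrightarrow> is_ideal I \<and> (\<forall>x\<in>I. \<forall>y\<in>I. x \<cdot> y = 0 \<and> \<lbrakk>x,y\<rbrakk> = 0)"

definition minimal_ideal :: "'v set \<Rightarrow> bool" where
  "minimal_ideal I \<longleftrightarrow> is_ideal I \<and> I \<noteq> {0} \<and> (\<forall>J. is_ideal J \<and> J \<noteq> {0} \<and> J \<subseteq> I \<longrightarrow> J = I)"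

definition minimal_zero_ideal :: "'v set \<Rightarrow> bool" where
  "minimal_zero_ideal I \<longleftrightarrow> minimal_ideal I \<and> zero_ideal I"

text \<open>The sum of a family of subspaces is the span of its union; the empty sum is \<open>{0}\<close>.\<close>

definition Zsoc :: "'v set" where
  "Zsoc = span (\<Union>{I. minimal_zero_ideal I})"

definition maximal_subalgebra :: "'v set \<Rightarrow> bool" where
  "maximal_subalgebra M \<longleftrightarrow>
     subalgebra M \<and> M \<noteq> UNIV \<and> (\<forall>S. subalgebra S \<and> S \<noteq> UNIV \<and> M \<subseteq> S \<longrightarrow> S = M)"

text \<open>If there are no maximal subalgebras, the intersection is the whole algebra.\<close>

definition frattini_subalgebra :: "'v set" where
  "frattini_subalgebra = \<Inter>{M. maximal_subalgebra M}"

definition frattini_ideal :: "'v set" where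
  "frattini_ideal = (GREATEST I. is_ideal I \<and> I \<subseteq> frattini_subalgebra)"

definition phi_free :: bool where
  "phi_free \<longleftrightarrow> frattini_ideal = {0}"

lemma subspace_frattini_subalgebra: "subspace frattini_subalgebra"
  unfolding frattini_subalgebra_def
  by (rule subspace_Inter) (auto simp: maximal_subalgebra_def subalgebra_def)

lemma is_ideal_span_Union:
  assumes "\<And>I. I \<in> \<I> \<Longrightarrow> is_ideal I"
  shows "is_ideal (span (\<Union>\<I>))"
proof -
  have "x \<cdot> y \<in> span (\<Union>\<I>) \<and> \<lbrakk>x,y\<rbrakk> \<in> span (\<Union>\<I>)" if "x \<in> span (\<Union>\<I>)" for x y
  proof -
    interpret m: Vector_Spaces.linear scale scale "\<lambda>x. x \<cdot> y" by (rule mul_linear_left)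
    interpret b: Vector_Spaces.linear scale scale "\<lambda>x. \<lbrakk>x,y\<rbrakk>" by (rule brk_linear_left)
    show ?thesis
      using that
    proof (induction rule: span_induct_alt)
      case base
      show ?case by (simp add: m.zero b.zero span_zero)
    next
      case (step c x z)
      then have "x \<cdot> y \<in> \<Union>\<I>" "\<lbrakk>x,y\<rbrakk> \<in> \<Union>\<I>"
        using assms unfolding is_ideal_def by blast+
      with step show ?case
        by (simp add: m.add m.scale b.add b.scale span_add span_scale span_base)
    qed
  qed
  then show ?thesis by (simp add: is_ideal_def)
qed

text \<open>The largest ideal contained in the Frattini subalgebra exists, so \<^const>\<open>frattini_ideal\<close> is
  determined by its definition.\<close>

lemma frattini_ideal:
  shows is_ideal_frattini_ideal: "is_ideal frattini_ideal"
    and frattini_ideal_subset: "frattini_ideal \<subseteq> frattini_subalgebra"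
    and frattini_ideal_greatest:
      "\<And>I. is_ideal I \<Longrightarrow> I \<subseteq> frattini_subalgebra \<Longrightarrow> I \<subseteq> frattini_ideal"
proof -
  let ?P = "\<lambda>I. is_ideal I \<and> I \<subseteq> frattini_subalgebra"
  let ?S = "span (\<Union>{I. ?P I})"
  have S: "?P ?S"
    using is_ideal_span_Union[of "{I. ?P I}"]
      span_minimal[OF _ subspace_frattini_subalgebra, of "\<Union>{I. ?P I}"] by blast
  have max: "I \<subseteq> ?S" if "?P I" for I
    using that span_superset[of "\<Union>{I. ?P I}"] by blast
  have eq: "frattini_ideal = ?S"
    unfolding frattini_ideal_def by (rule Greatest_equality) (use S max in auto)
  show "is_ideal frattini_ideal" "frattini_ideal \<subseteq> frattini_subalgebra"
    using S by (simp_all add: eq)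
  show "I \<subseteq> frattini_ideal" if "is_ideal I" "I \<subseteq> frattini_subalgebra" for I
    using max that unfolding eq by blast
qed

end

end

theory Submission
  imports Defs
begin

text \<open>
  Let \<open>Z\<close> be the zero socle. Distinct minimal zero ideals annihilate each other, so \<open>Z\<close> is itself a zero
  ideal. Consequently the intersection of \<open>Z\<close> with any subalgebra that supplements it is an ideal of the
  whole algebra.

  If the algebra is \<open>\<phi>\<close>-free, take a supplement \<open>C\<close> of \<open>Z\<close> that is minimal among subalgebras. The ideal
  \<open>Z \<inter> C\<close> lies in every maximal subalgebra \<open>M\<close>, for otherwise \<open>M \<inter> C\<close> would be a smaller supplement;
  hence \<open>Z \<inter> C\<close> lies in the Frattini ideal and vanishes
  (\<open>phi_free_splits_over_zero_ideal\<close>).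

  Conversely, suppose that \<open>C\<close> complements \<open>Z\<close>. Since \<open>Z\<close> is a sum of minimal ideals, each minimal zero
  ideal \<open>A\<close> has a complement \<open>B\<close> in \<open>Z\<close> that is an ideal, and \<open>B + C\<close> is a maximal subalgebra meeting \<open>A\<close>
  trivially (\<open>split_minimal_zero_ideal_avoids_maximal\<close>). So no minimal zero ideal lies in the
  Frattini ideal. If the Frattini ideal is nonzero, it contains a minimal ideal \<open>N\<close>, and a
  contradiction follows once \<open>N\<close> is known to be a zero ideal.

  That is the main point (\<open>minimal_ideal_in_frattini_zero\<close>). For \<open>x \<in> N\<close> consider the operators
  \<open>y \<mapsto> x \<cdot> y\<close> and \<open>y \<mapsto> \<lbrakk>x,y\<rbrakk>\<close>. Their Fitting null components are subalgebras, their Fitting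
  one-components lie in \<open>N\<close>, and a subalgebra that together with \<open>N\<close> spans everything is
  everything, because \<open>N\<close> consists of non-generators. Hence all these operators are nilpotent.
  A minimality argument for the commutative product and Engel's theorem for the bracket give nonzero
  elements of \<open>N\<close> annihilated by \<open>N\<close>. The annihilators of \<open>N\<close> in \<open>N\<close> are ideals, so by minimality both
  products vanish on \<open>N\<close>.
\<close>

section \<open>Calculation rules\<close>

context poisson_algebra
begin

lemma mul_simps:
  "(x + y) \<cdot> z = x \<cdot> z + y \<cdot> z" "z \<cdot> (x + y) = z \<cdot> x + z \<cdot> y"
  "(x - y) \<cdot> z = x \<cdot> z - y \<cdot> z" "z \<cdot> (x - y) = z \<cdot> x - z \<cdot> y"
  "(c *s x) \<cdot> z = c *s (x \<cdot> z)" "z \<cdot> (c *s x) = c *s (z \<cdot> x)"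
  "0 \<cdot> z = 0" "z \<cdot> 0 = 0"
proof -
  interpret l: Vector_Spaces.linear scale scale "\<lambda>x. x \<cdot> z" by (rule mul_linear_left)
  interpret r: Vector_Spaces.linear scale scale "\<lambda>x. z \<cdot> x" by (rule mul_linear_right)
  show "(x + y) \<cdot> z = x \<cdot> z + y \<cdot> z" "z \<cdot> (x + y) = z \<cdot> x + z \<cdot> y"
    "(x - y) \<cdot> z = x \<cdot> z - y \<cdot> z" "z \<cdot> (x - y) = z \<cdot> x - z \<cdot> y"
    "(c *s x) \<cdot> z = c *s (x \<cdot> z)" "z \<cdot> (c *s x) = c *s (z \<cdot> x)"
    "0 \<cdot> z = 0" "z \<cdot> 0 = 0"
    by (fact l.add r.add l.diff r.diff l.scale r.scale l.zero r.zero)+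
qed

lemma brk_simps:
  "\<lbrakk>x + y,z\<rbrakk> = \<lbrakk>x,z\<rbrakk> + \<lbrakk>y,z\<rbrakk>" "\<lbrakk>z,x + y\<rbrakk> = \<lbrakk>z,x\<rbrakk> + \<lbrakk>z,y\<rbrakk>"
  "\<lbrakk>x - y,z\<rbrakk> = \<lbrakk>x,z\<rbrakk> - \<lbrakk>y,z\<rbrakk>" "\<lbrakk>z,x - y\<rbrakk> = \<lbrakk>z,x\<rbrakk> - \<lbrakk>z,y\<rbrakk>"
  "\<lbrakk>c *s x,z\<rbrakk> = c *s \<lbrakk>x,z\<rbrakk>" "\<lbrakk>z,c *s x\<rbrakk> = c *s \<lbrakk>z,x\<rbrakk>"
  "\<lbrakk>0,z\<rbrakk> = 0" "\<lbrakk>z,0\<rbrakk> = 0" "\<lbrakk>- x,z\<rbrakk> = - \<lbrakk>x,z\<rbrakk>" "\<lbrakk>z,- x\<rbrakk> = - \<lbrakk>z,x\<rbrakk>"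
proof -
  interpret l: Vector_Spaces.linear scale scale "\<lambda>x. \<lbrakk>x,z\<rbrakk>" by (rule brk_linear_left)
  interpret r: Vector_Spaces.linear scale scale "\<lambda>x. \<lbrakk>z,x\<rbrakk>" by (rule brk_linear_right)
  show "\<lbrakk>x + y,z\<rbrakk> = \<lbrakk>x,z\<rbrakk> + \<lbrakk>y,z\<rbrakk>" "\<lbrakk>z,x + y\<rbrakk> = \<lbrakk>z,x\<rbrakk> + \<lbrakk>z,y\<rbrakk>"
    "\<lbrakk>x - y,z\<rbrakk> = \<lbrakk>x,z\<rbrakk> - \<lbrakk>y,z\<rbrakk>" "\<lbrakk>z,x - y\<rbrakk> = \<lbrakk>z,x\<rbrakk> - \<lbrakk>z,y\<rbrakk>"
    "\<lbrakk>c *s x,z\<rbrakk> = c *s \<lbrakk>x,z\<rbrakk>" "\<lbrakk>z,c *s x\<rbrakk> = c *s \<lbrakk>z,x\<rbrakk>"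
    "\<lbrakk>0,z\<rbrakk> = 0" "\<lbrakk>z,0\<rbrakk> = 0" "\<lbrakk>- x,z\<rbrakk> = - \<lbrakk>x,z\<rbrakk>" "\<lbrakk>z,- x\<rbrakk> = - \<lbrakk>z,x\<rbrakk>"
    by (fact l.add r.add l.diff r.diff l.scale r.scale l.zero r.zero l.neg r.neg)+
qed

lemma brk_anticommute: "\<lbrakk>x,y\<rbrakk> = - \<lbrakk>y,x\<rbrakk>"
proof -
  have "\<lbrakk>x + y,x + y\<rbrakk> = 0" by (rule brk_alternating)
  then have "\<lbrakk>x,x\<rbrakk> + \<lbrakk>y,x\<rbrakk> + (\<lbrakk>x,y\<rbrakk> + \<lbrakk>y,y\<rbrakk>) = 0" by (simp only: brk_simps)
  then show ?thesis by (simp add: brk_alternating eq_neg_iff_add_eq_0 add.commute)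
qed

lemma brk_derivation: "\<lbrakk>x,\<lbrakk>y,z\<rbrakk>\<rbrakk> = \<lbrakk>\<lbrakk>x,y\<rbrakk>,z\<rbrakk> + \<lbrakk>y,\<lbrakk>x,z\<rbrakk>\<rbrakk>"
proof -
  have "\<lbrakk>y,\<lbrakk>z,x\<rbrakk>\<rbrakk> = - \<lbrakk>y,\<lbrakk>x,z\<rbrakk>\<rbrakk>" "\<lbrakk>z,\<lbrakk>x,y\<rbrakk>\<rbrakk> = - \<lbrakk>\<lbrakk>x,y\<rbrakk>,z\<rbrakk>"
    by (metis brk_anticommute brk_simps(10), metis brk_anticommute)
  with jacobi[of x y z] show ?thesis by (simp add: algebra_simps)
qed

lemma brk_mul_derivation: "\<lbrakk>x,y \<cdot> z\<rbrakk> = \<lbrakk>x,y\<rbrakk> \<cdot> z + y \<cdot> \<lbrakk>x,z\<rbrakk>"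
proof -
  have "\<lbrakk>x,y \<cdot> z\<rbrakk> = - (\<lbrakk>y,x\<rbrakk> \<cdot> z + y \<cdot> \<lbrakk>z,x\<rbrakk>)"
    by (metis brk_anticommute leibniz)
  also have "\<dots> = (0 - \<lbrakk>y,x\<rbrakk>) \<cdot> z + y \<cdot> (0 - \<lbrakk>z,x\<rbrakk>)"
    by (simp only: mul_simps) simp
  also have "\<dots> = \<lbrakk>x,y\<rbrakk> \<cdot> z + y \<cdot> \<lbrakk>x,z\<rbrakk>"
    by (metis brk_anticommute diff_0)
  finally show ?thesis .
qed

section \<open>Sums of subspaces, ideals and subalgebras\<close>

definition subspace_sum :: "'v set \<Rightarrow> 'v set \<Rightarrow> 'v set" (infixl \<open>\<oplus>\<close> 65) where
  "A \<oplus> B = {a + b | a b. a \<in> A \<and> b \<in> B}"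

lemma sum_memI [intro]: "a \<in> A \<Longrightarrow> b \<in> B \<Longrightarrow> a + b \<in> A \<oplus> B"
  by (auto simp: subspace_sum_def)

lemma sum_memE [elim!]:
  assumes "x \<in> A \<oplus> B"
  obtains a b where "x = a + b" "a \<in> A" "b \<in> B"
  using assms by (auto simp: subspace_sum_def)

lemma sum_UNIV_E:
  assumes "A \<oplus> B = UNIV"
  obtains a b where "v = a + b" "a \<in> A" "b \<in> B"
  using assms by (metis UNIV_I sum_memE)

lemma subspace_subspace_sum: "subspace A \<Longrightarrow> subspace B \<Longrightarrow> subspace (A \<oplus> B)"
  unfolding subspace_sum_def by (rule subspace_sums)

lemma sum_superset:
  assumes "subspace A" "subspace B"
  shows "A \<subseteq> A \<oplus> B" "B \<subseteq> A \<oplus> B"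
proof -
  show "A \<subseteq> A \<oplus> B" using sum_memI[OF _ subspace_0[OF assms(2)], of _ A] by auto
  show "B \<subseteq> A \<oplus> B" using sum_memI[OF subspace_0[OF assms(1)], of _ B] by auto
qed

lemma sum_minimal:
  assumes "subspace S" "A \<subseteq> S" "B \<subseteq> S"
  shows "A \<oplus> B \<subseteq> S"
  using assms by (auto intro: subspace_add)

lemma subalgebraD:
  assumes "subalgebra S"
  shows "subspace S" "\<And>x y. x \<in> S \<Longrightarrow> y \<in> S \<Longrightarrow> x \<cdot> y \<in> S" "\<And>x y. x \<in> S \<Longrightarrow> y \<in> S \<Longrightarrow> \<lbrakk>x,y\<rbrakk> \<in> S"
  using assms by (auto simp: subalgebra_def)

lemma idealD:
  assumes "is_ideal I"
  shows "subspace I" "\<And>x y. x \<in> I \<Longrightarrow> x \<cdot> y \<in> I" "\<And>x y. x \<in> I \<Longrightarrow> y \<cdot> x \<in> I"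
    "\<And>x y. x \<in> I \<Longrightarrow> \<lbrakk>x,y\<rbrakk> \<in> I" "\<And>x y. x \<in> I \<Longrightarrow> \<lbrakk>y,x\<rbrakk> \<in> I"
proof -
  show s: "subspace I" and "x \<in> I \<Longrightarrow> x \<cdot> y \<in> I" and b: "x \<in> I \<Longrightarrow> \<lbrakk>x,y\<rbrakk> \<in> I" for x y
    using assms by (auto simp: is_ideal_def)
  then show "x \<in> I \<Longrightarrow> y \<cdot> x \<in> I" for x y by (metis mul_commute)
  show "x \<in> I \<Longrightarrow> \<lbrakk>y,x\<rbrakk> \<in> I" for x y by (metis b s brk_anticommute subspace_neg)
qed

lemma ideal_Int:
  assumes "is_ideal I" "is_ideal J"
  shows "is_ideal (I \<inter> J)"
  using assms by (auto simp: is_ideal_def intro: subspace_inter)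

lemma ideal_sum:
  assumes "is_ideal I" "is_ideal J"
  shows "is_ideal (I \<oplus> J)"
  unfolding is_ideal_def
proof (intro conjI ballI allI)
  show "subspace (I \<oplus> J)" using assms by (intro subspace_subspace_sum idealD)
  fix x y assume "x \<in> I \<oplus> J"
  then obtain a b where ab: "x = a + b" "a \<in> I" "b \<in> J" by blast
  show "x \<cdot> y \<in> I \<oplus> J" "\<lbrakk>x,y\<rbrakk> \<in> I \<oplus> J"
    using idealD(2,4)[OF assms(1) ab(2), of y] idealD(2,4)[OF assms(2) ab(3), of y]
    unfolding ab(1) mul_simps brk_simps by blast+
qed

lemma subalgebra_ideal_sum:
  assumes I: "is_ideal I" and S: "subalgebra S"
  shows "subalgebra (I \<oplus> S)"
  unfolding subalgebra_def
proof (intro conjI ballI)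
  show "subspace (I \<oplus> S)" using assms by (intro subspace_subspace_sum idealD subalgebraD)
  fix x y assume "x \<in> I \<oplus> S" "y \<in> I \<oplus> S"
  then obtain a b a' b' where ab: "x = a + b" "a \<in> I" "b \<in> S" "y = a' + b'" "a' \<in> I" "b' \<in> S"
    by blast
  have "x \<cdot> y = (a \<cdot> y + b \<cdot> a') + b \<cdot> b'" "\<lbrakk>x,y\<rbrakk> = (\<lbrakk>a,y\<rbrakk> + \<lbrakk>b,a'\<rbrakk>) + \<lbrakk>b,b'\<rbrakk>"
    unfolding ab(1,4) by (simp_all add: mul_simps brk_simps)
  moreover have "a \<cdot> y + b \<cdot> a' \<in> I" "\<lbrakk>a,y\<rbrakk> + \<lbrakk>b,a'\<rbrakk> \<in> I"
    using ab idealD(2-5)[OF I] by (auto intro!: subspace_add[OF idealD(1)[OF I]])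
  moreover have "b \<cdot> b' \<in> S" "\<lbrakk>b,b'\<rbrakk> \<in> S"
    using ab subalgebraD[OF S] by auto
  ultimately show "x \<cdot> y \<in> I \<oplus> S" "\<lbrakk>x,y\<rbrakk> \<in> I \<oplus> S"
    by (simp_all only: sum_memI)
qed

lemma subalgebra_Int: "subalgebra S \<Longrightarrow> subalgebra T \<Longrightarrow> subalgebra (S \<inter> T)"
  by (auto simp: subalgebra_def intro: subspace_inter)

text \<open>A zero ideal annihilates itself, so when it is supplemented by a subalgebra \<open>S\<close>,
  only products with elements of \<open>S\<close> matter.\<close>

lemma ideal_zero_ideal_Int_supplement:
  assumes Z: "zero_ideal Z" and S: "subalgebra S" and sum: "Z \<oplus> S = UNIV"
  shows "is_ideal (Z \<inter> S)"
  unfolding is_ideal_def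
proof (intro conjI ballI allI)
  have I: "is_ideal Z" using Z by (simp add: zero_ideal_def)
  show "subspace (Z \<inter> S)" using idealD(1)[OF I] subalgebraD(1)[OF S] by (rule subspace_inter)
  fix x y assume x: "x \<in> Z \<inter> S"
  obtain z s where y: "y = z + s" "z \<in> Z" "s \<in> S" using sum by (rule sum_UNIV_E)
  have "x \<cdot> y = x \<cdot> s" "\<lbrakk>x,y\<rbrakk> = \<lbrakk>x,s\<rbrakk>"
    using Z x y by (auto simp: zero_ideal_def mul_simps brk_simps)
  then show "x \<cdot> y \<in> Z \<inter> S" "\<lbrakk>x,y\<rbrakk> \<in> Z \<inter> S"
    using idealD[OF I] subalgebraD[OF S] x y by auto
qed

section \<open>The zero socle\<close>

lemma minimal_idealD:
  assumes "minimal_ideal I"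
  shows "is_ideal I" "I \<noteq> {0}" "\<And>J. is_ideal J \<Longrightarrow> J \<subseteq> I \<Longrightarrow> J = {0} \<or> J = I"
  using assms by (auto simp: minimal_ideal_def)

text \<open>Two distinct minimal ideals meet in \<open>0\<close>, and both products of them lie in the intersection.\<close>

lemma minimal_zero_ideals_annihilate:
  assumes I: "minimal_zero_ideal I" and J: "minimal_zero_ideal J" and x: "x \<in> I" and y: "y \<in> J"
  shows "x \<cdot> y = 0 \<and> \<lbrakk>x,y\<rbrakk> = 0"
proof (cases "I = J")
  case True
  then show ?thesis using I x y by (auto simp: minimal_zero_ideal_def zero_ideal_def)
next
  case False
  have mI: "minimal_ideal I" and mJ: "minimal_ideal J"
    using I J by (auto simp: minimal_zero_ideal_def)
  have "I \<inter> J = {0}"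
    using minimal_idealD(3)[OF mI, of "I \<inter> J"] minimal_idealD(3)[OF mJ, of "I \<inter> J"]
      ideal_Int[OF minimal_idealD(1)[OF mI] minimal_idealD(1)[OF mJ]] False by auto
  then show ?thesis
    using idealD(2,4)[OF minimal_idealD(1)[OF mI] x, of y]
      idealD(3,5)[OF minimal_idealD(1)[OF mJ] y, of x] by auto
qed

lemma ideal_Zsoc: "is_ideal Zsoc"
  unfolding Zsoc_def
  by (rule is_ideal_span_Union) (auto simp: minimal_zero_ideal_def zero_ideal_def)

lemma minimal_zero_ideal_subset_Zsoc: "minimal_zero_ideal I \<Longrightarrow> I \<subseteq> Zsoc"
  unfolding Zsoc_def by (intro order_trans[OF _ span_superset] Union_upper CollectI)

lemma zero_ideal_Zsoc: "zero_ideal Zsoc"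
  unfolding zero_ideal_def
proof (intro conjI[OF ideal_Zsoc] ballI)
  let ?U = "\<Union>{I. minimal_zero_ideal I}"
  have sub1: "subspace {y. x \<cdot> y = 0 \<and> \<lbrakk>x,y\<rbrakk> = 0}" for x
    by (rule subspaceI) (auto simp: mul_simps brk_simps)
  have sub2: "subspace {x. x \<cdot> y = 0 \<and> \<lbrakk>x,y\<rbrakk> = 0}" for y
    by (rule subspaceI) (auto simp: mul_simps brk_simps)
  fix x y assume x: "x \<in> Zsoc" and y: "y \<in> Zsoc"
  have "x \<cdot> u = 0 \<and> \<lbrakk>x,u\<rbrakk> = 0" if "u \<in> ?U" for u
  proof -
    have "Zsoc \<subseteq> {x. x \<cdot> u = 0 \<and> \<lbrakk>x,u\<rbrakk> = 0}"
      unfolding Zsoc_def using that minimal_zero_ideals_annihilate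
      by (intro span_minimal sub2) blast
    then show ?thesis using x by auto
  qed
  then have "Zsoc \<subseteq> {y. x \<cdot> y = 0 \<and> \<lbrakk>x,y\<rbrakk> = 0}"
    unfolding Zsoc_def by (intro span_minimal sub1) blast
  then show "x \<cdot> y = 0 \<and> \<lbrakk>x,y\<rbrakk> = 0" using y by auto
qed

end

locale finite_dimensional_poisson_algebra =
  poisson_algebra scale mul brk + finite_dimensional_vector_space scale Basis
  for scale :: "'f::field \<Rightarrow> 'v::ab_group_add \<Rightarrow> 'v" (infixr \<open>*s\<close> 75)
    and mul :: "'v \<Rightarrow> 'v \<Rightarrow> 'v" (infixl \<open>\<cdot>\<close> 70)
    and brk :: "'v \<Rightarrow> 'v \<Rightarrow> 'v" (\<open>\<lbrakk>_,_\<rbrakk>\<close>)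
    and Basis :: "'v set"
begin

section \<open>Finite-dimensional existence principles\<close>

lemma maximal_subspace_exists:
  assumes "P S0" and sub: "\<And>S. P S \<Longrightarrow> subspace S"
  obtains S where "P S" "\<And>T. P T \<Longrightarrow> S \<subseteq> T \<Longrightarrow> T = S"
proof -
  have "\<exists>S. P S \<and> (\<forall>T. P T \<longrightarrow> dim T \<le> dim S)"
    using assms(1) dim_subset_UNIV
    by (intro ex_has_greatest_nat[where b = "Suc dimension"]) (auto simp: less_Suc_eq_le)
  then obtain S where S: "P S" "\<And>T. P T \<Longrightarrow> dim T \<le> dim S" by blast
  have "T = S" if "P T" "S \<subseteq> T" for T
    using subspace_dim_equal[OF sub[OF S(1)] sub[OF that(1)] that(2)] S(2)[OF that(1)] by simp
  with S(1) show ?thesis by (rule that)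
qed

lemma minimal_subspace_exists:
  assumes "P S0" and sub: "\<And>S. P S \<Longrightarrow> subspace S"
  obtains S where "P S" "\<And>T. P T \<Longrightarrow> T \<subseteq> S \<Longrightarrow> T = S"
proof -
  obtain S where S: "P S" "\<And>T. P T \<Longrightarrow> dim S \<le> dim T"
    using ex_has_least_nat[of P S0 dim] assms(1) by blast
  have "T = S" if "P T" "T \<subseteq> S" for T
    using subspace_dim_equal[OF sub[OF that(1)] sub[OF S(1)] that(2)] S(2)[OF that(1)] by simp
  with S(1) show ?thesis by (rule that)
qed

lemma linear_image_subspace:
  assumes "Vector_Spaces.linear scale scale f" "subspace S"
  shows "subspace (f ` S)"
proof -
  interpret f: Vector_Spaces.linear scale scale f by fact
  show ?thesis using assms(2) by (rule f.subspace_image)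
qed

lemma linear_funpow:
  assumes "Vector_Spaces.linear scale scale f"
  shows "Vector_Spaces.linear scale scale (f ^^ n)"
proof (induction n)
  case 0
  show ?case using Vector_Spaces.vector_space.linear_id[OF vector_space_axioms] by (simp add: id_def)
next
  case (Suc n)
  show ?case using Vector_Spaces.linear_compose[OF Suc assms] by (simp only: funpow.simps)
qed

text \<open>Fitting's lemma. The ranges of the powers of \<open>f\<close> decrease, hence stabilise at some \<open>k\<close>; then
  \<open>f\<^sup>k v = f\<^sup>k (f\<^sup>k u)\<close> for some \<open>u\<close>, and \<open>v - f\<^sup>k u\<close> is killed by \<open>f\<^sup>k\<close>. The exponent is taken
  positive so that \<open>f\<^sup>k u\<close> lies in the range of \<open>f\<close>.\<close>

lemma fitting_decomposition:
  assumes f: "Vector_Spaces.linear scale scale f"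
  obtains k where "k > 0" "\<And>v. \<exists>a u. v = a + (f ^^ k) u \<and> (f ^^ k) a = 0"
proof -
  let ?P = "\<lambda>R. \<exists>k>0. R = range (f ^^ k)"
  have "?P (range (f ^^ 1))" by (intro exI[of _ 1]) simp
  moreover have "subspace S" if "?P S" for S
    using that linear_image_subspace[OF linear_funpow[OF f] subspace_UNIV] by blast
  ultimately obtain R where "?P R" and min: "\<And>T. ?P T \<Longrightarrow> T \<subseteq> R \<Longrightarrow> T = R"
    by (rule minimal_subspace_exists[of ?P]) blast+
  then obtain k where k: "k > 0" "R = range (f ^^ k)" by blast
  have "range (f ^^ (k + k)) \<subseteq> range (f ^^ k)" by (auto simp: funpow_add)
  then have eq: "range (f ^^ (k + k)) = range (f ^^ k)"
    using min[of "range (f ^^ (k + k))"] k by (metis add_gr_0)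
  interpret fk: Vector_Spaces.linear scale scale "f ^^ k" by (rule linear_funpow[OF f])
  have "\<exists>a u. v = a + (f ^^ k) u \<and> (f ^^ k) a = 0" for v
  proof -
    obtain u where "(f ^^ k) v = (f ^^ (k + k)) u" using eq by blast
    then have "(f ^^ k) (v - (f ^^ k) u) = 0" by (simp add: fk.diff funpow_add)
    then show ?thesis by (intro exI[of _ "v - (f ^^ k) u"] exI[of _ u]) simp
  qed
  with k(1) show ?thesis using that by blast
qed

section \<open>The Frattini subalgebra consists of non-generators\<close>

lemma frattini_supplement_trivial:
  assumes S: "subalgebra S" and N: "N \<subseteq> frattini_subalgebra" and sum: "N \<oplus> S = UNIV"
  shows "S = UNIV"
proof (rule ccontr)
  assume ne: "S \<noteq> UNIV"
  obtain M where M: "subalgebra M \<and> M \<noteq> UNIV \<and> S \<subseteq> M"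
    and max: "\<And>T. subalgebra T \<and> T \<noteq> UNIV \<and> S \<subseteq> T \<Longrightarrow> M \<subseteq> T \<Longrightarrow> T = M"
    by (rule maximal_subspace_exists[of "\<lambda>M. subalgebra M \<and> M \<noteq> UNIV \<and> S \<subseteq> M" S])
      (use S ne in \<open>auto simp: subalgebra_def\<close>)
  then have "maximal_subalgebra M" unfolding maximal_subalgebra_def by blast
  then have "N \<subseteq> M" using N unfolding frattini_subalgebra_def by blast
  then have "N \<oplus> S \<subseteq> M" using M by (intro sum_minimal subalgebraD) auto
  with M sum show False by auto
qed

text \<open>Of all subalgebras supplementing \<open>Z\<close> a minimal one, \<open>C\<close>, meets \<open>Z\<close> inside the Frattini subalgebra:
  a maximal subalgebra \<open>M\<close> not containing \<open>Z \<inter> C\<close> would make \<open>M \<inter> C\<close> a smaller supplement, by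
  the modular law.\<close>

lemma phi_free_splits_over_zero_ideal:
  assumes phi_free and Z: "zero_ideal Z"
  obtains C where "subalgebra C" "Z \<oplus> C = UNIV" "Z \<inter> C = {0}"
proof -
  have I: "is_ideal Z" using Z by (simp add: zero_ideal_def)
  have "Z \<oplus> UNIV = UNIV" using sum_superset(2)[OF idealD(1)[OF I] subspace_UNIV] by blast
  then have "subalgebra UNIV \<and> Z \<oplus> UNIV = UNIV" by (simp add: subalgebra_def)
  then obtain C where C: "subalgebra C \<and> Z \<oplus> C = UNIV"
    and min: "\<And>T. subalgebra T \<and> Z \<oplus> T = UNIV \<Longrightarrow> T \<subseteq> C \<Longrightarrow> T = C"
    by (rule minimal_subspace_exists[of "\<lambda>C. subalgebra C \<and> Z \<oplus> C = UNIV"])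
      (use subalgebraD(1) in blast)+
  have ZC: "is_ideal (Z \<inter> C)" using ideal_zero_ideal_Int_supplement[OF Z] C by blast
  have "Z \<inter> C \<subseteq> M" if M: "maximal_subalgebra M" for M
  proof (rule ccontr)
    assume nsub: "\<not> Z \<inter> C \<subseteq> M"
    have sM: "subalgebra M" using M by (simp add: maximal_subalgebra_def)
    note sup = sum_superset[OF idealD(1)[OF ZC] subalgebraD(1)[OF sM]]
    have "(Z \<inter> C) \<oplus> M \<noteq> M"
    proof
      assume "(Z \<inter> C) \<oplus> M = M"
      with sup(1) have "Z \<inter> C \<subseteq> M" by (simp only:)
      with nsub show False ..
    qed
    moreover have "T = UNIV \<or> T = M" if "subalgebra T" "M \<subseteq> T" for T
      using M that by (auto simp: maximal_subalgebra_def)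
    note this[OF subalgebra_ideal_sum[OF ZC sM] sup(2)]
    ultimately have supM: "(Z \<inter> C) \<oplus> M = UNIV" by metis
    have "v \<in> Z \<oplus> (M \<inter> C)" for v
    proof -
      obtain z c where v: "v = z + c" "z \<in> Z" "c \<in> C" using C by (elim conjE sum_UNIV_E)
      obtain a m where c: "c = a + m" "a \<in> Z \<inter> C" "m \<in> M" using supM by (rule sum_UNIV_E)
      have sC: "subspace C" using C subalgebraD(1) by blast
      have "m = c - a" using c by simp
      then have "m \<in> C" using subspace_diff[OF sC v(3)] c(2) by blast
      moreover have "z + a \<in> Z" using v c idealD(1)[OF I] by (auto intro: subspace_add)
      moreover have "v = (z + a) + m" using v c by simp
      ultimately show ?thesis using c(3) by blast
    qed
    then have "M \<inter> C = C" using min[of "M \<inter> C"] sM C subalgebra_Int by blast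
    then show False using nsub by blast
  qed
  then have "Z \<inter> C \<subseteq> frattini_ideal"
    by (intro frattini_ideal_greatest ZC) (auto simp: frattini_subalgebra_def)
  then have "Z \<inter> C = {0}"
    using assms(1) subspace_0[OF idealD(1)[OF ZC]] unfolding phi_free_def by blast
  with C show ?thesis using that by blast
qed

section \<open>Ideals of non-generators act nilpotently\<close>

definition fitting_null :: "('v \<Rightarrow> 'v) \<Rightarrow> 'v set" where
  "fitting_null f = {v. \<exists>n. (f ^^ n) v = 0}"

lemma funpow_zero_mono:
  assumes "Vector_Spaces.linear scale scale f" "(f ^^ m) v = 0" "m \<le> n"
  shows "(f ^^ n) v = 0"
proof -
  interpret g: Vector_Spaces.linear scale scale "f ^^ (n - m)" by (rule linear_funpow[OF assms(1)])
  have "(f ^^ n) v = (f ^^ (n - m)) ((f ^^ m) v)"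
    using funpow_add[of "n - m" m f] assms(3) by simp
  then show ?thesis by (simp add: assms(2) g.zero)
qed

lemma subspace_fitting_null:
  assumes f: "Vector_Spaces.linear scale scale f"
  shows "subspace (fitting_null f)"
proof (rule subspaceI)
  show "0 \<in> fitting_null f" by (auto simp: fitting_null_def intro: exI[of _ 0])
  show "x + y \<in> fitting_null f" if xy: "x \<in> fitting_null f" "y \<in> fitting_null f" for x y
  proof -
    obtain m n where mn: "(f ^^ m) x = 0" "(f ^^ n) y = 0" using xy by (auto simp: fitting_null_def)
    interpret g: Vector_Spaces.linear scale scale "f ^^ (m + n)" by (rule linear_funpow[OF f])
    have "(f ^^ (m + n)) (x + y) = 0"
      using funpow_zero_mono[OF f mn(1), of "m + n"] funpow_zero_mono[OF f mn(2), of "m + n"]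
      by (simp add: g.add)
    then show ?thesis by (auto simp: fitting_null_def)
  qed
  show "c *s x \<in> fitting_null f" if x: "x \<in> fitting_null f" for c x
  proof -
    obtain m where m: "(f ^^ m) x = 0" using x by (auto simp: fitting_null_def)
    interpret g: Vector_Spaces.linear scale scale "f ^^ m" by (rule linear_funpow[OF f])
    have "(f ^^ m) (c *s x) = 0" using m by (simp add: g.scale)
    then show ?thesis by (auto simp: fitting_null_def)
  qed
qed

text \<open>The Fitting one-component of \<open>f\<close> lies in the range of \<open>f\<close>, so the null component supplements
  any subspace containing that range.\<close>

lemma frattini_fitting_null:
  assumes f: "Vector_Spaces.linear scale scale f" and "range f \<subseteq> N"
    and "N \<subseteq> frattini_subalgebra" and "subalgebra (fitting_null f)"
  shows "fitting_null f = UNIV"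
proof (rule frattini_supplement_trivial)
  obtain k where k: "k > 0" "\<And>v. \<exists>a u. v = a + (f ^^ k) u \<and> (f ^^ k) a = 0"
    using fitting_decomposition[OF f] by blast
  have "v \<in> N \<oplus> fitting_null f" for v
  proof -
    obtain a u where v: "v = (f ^^ k) u + a" "(f ^^ k) a = 0"
      using k(2)[of v] by (auto simp: add.commute)
    have "(f ^^ k) u = f ((f ^^ (k - 1)) u)" using k(1) by (cases k) auto
    then have "(f ^^ k) u \<in> N" using assms(2) by auto
    moreover have "a \<in> fitting_null f" using v(2) by (auto simp: fitting_null_def)
    ultimately show ?thesis using v(1) by blast
  qed
  then show "N \<oplus> fitting_null f = UNIV" by blast
qed fact+

text \<open>By the Leibniz rule \<open>D\<^sup>k (p y z)\<close> is a combination of terms \<open>p (D\<^sup>i y) (D\<^sup>j z)\<close> with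
  \<open>i + j = k\<close>; the induction on \<open>m + n\<close> peels off one \<open>D\<close> at a time and so avoids binomial
  coefficients. It shows that the Fitting null component of \<open>y \<mapsto> \<lbrakk>x,y\<rbrakk>\<close> is closed under both
  products.\<close>

lemma derivation_funpow_zero:
  fixes p :: "'v \<Rightarrow> 'v \<Rightarrow> 'v"
  assumes D: "Vector_Spaces.linear scale scale D"
    and p0: "\<And>z. p 0 z = 0" "\<And>y. p y 0 = 0"
    and der: "\<And>y z. D (p y z) = p (D y) z + p y (D z)"
  shows "(D ^^ m) y = 0 \<Longrightarrow> (D ^^ n) z = 0 \<Longrightarrow> (D ^^ (m + n)) (p y z) = 0"
proof (induction "m + n" arbitrary: m n y z)
  case 0
  then show ?case by (simp add: p0)
next
  case (Suc k)
  interpret g: Vector_Spaces.linear scale scale "D ^^ k" by (rule linear_funpow[OF D])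
  interpret h: Vector_Spaces.linear scale scale "D ^^ (m + n)" by (rule linear_funpow[OF D])
  show ?case
  proof (cases "m = 0 \<or> n = 0")
    case True
    then have "y = 0 \<or> z = 0" using Suc.prems by auto
    then show ?thesis using h.zero by (auto simp: p0)
  next
    case False
    then obtain m' n' where mn: "m = Suc m'" "n = Suc n'" by (auto simp: gr0_conv_Suc)
    have "(D ^^ (m' + n)) (p (D y) z) = 0"
      using Suc.hyps(2) Suc.prems mn by (intro Suc.hyps(1)) (auto simp: funpow_swap1)
    moreover have "(D ^^ (m + n')) (p y (D z)) = 0"
      using Suc.hyps(2) Suc.prems mn by (intro Suc.hyps(1)) (auto simp: funpow_swap1)
    moreover have "k = m' + n" "k = m + n'" using Suc.hyps(2) mn by auto
    ultimately have "(D ^^ k) (p (D y) z) = 0" "(D ^^ k) (p y (D z)) = 0" by simp_all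
    then have "(D ^^ k) (D (p y z)) = 0" by (simp add: der g.add)
    then show ?thesis by (simp flip: Suc.hyps(2) add: funpow_swap1)
  qed
qed

lemma brk_nilpotent_if_ideal_in_frattini:
  assumes N: "is_ideal N" "N \<subseteq> frattini_subalgebra" and x: "x \<in> N"
  shows "\<exists>n. ((\<lambda>y. \<lbrakk>x,y\<rbrakk>) ^^ n) v = 0"
proof -
  let ?D = "\<lambda>y. \<lbrakk>x,y\<rbrakk>"
  have D: "Vector_Spaces.linear scale scale ?D" by (rule brk_linear_right)
  have "subalgebra (fitting_null ?D)"
    unfolding subalgebra_def
  proof (intro conjI ballI subspace_fitting_null D)
    fix y z assume "y \<in> fitting_null ?D" "z \<in> fitting_null ?D"
    then obtain m n where mn: "(?D ^^ m) y = 0" "(?D ^^ n) z = 0" by (auto simp: fitting_null_def)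
    have "(?D ^^ (m + n)) (y \<cdot> z) = 0"
      by (rule derivation_funpow_zero[OF D _ _ _ mn]) (simp_all add: mul_simps brk_mul_derivation)
    then show "y \<cdot> z \<in> fitting_null ?D" by (auto simp: fitting_null_def)
    have "(?D ^^ (m + n)) \<lbrakk>y,z\<rbrakk> = 0"
      by (rule derivation_funpow_zero[OF D _ _ _ mn]) (simp_all add: brk_simps brk_derivation[of x])
    then show "\<lbrakk>y,z\<rbrakk> \<in> fitting_null ?D" by (auto simp: fitting_null_def)
  qed
  moreover have "range ?D \<subseteq> N" using idealD(4)[OF N(1) x] by auto
  ultimately have "fitting_null ?D = UNIV" using frattini_fitting_null[OF D _ N(2)] by blast
  then show ?thesis by (auto simp: fitting_null_def)
qed

text \<open>This makes the Fitting null component of \<open>y \<mapsto> x \<cdot> y\<close> closed under the bracket.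
  The exponent grows by one because \<open>x \<cdot> \<lbrakk>y,z\<rbrakk> = \<lbrakk>x \<cdot> y,z\<rbrakk> - y \<cdot> \<lbrakk>x,z\<rbrakk>\<close>
  leaves the correction term \<open>y \<cdot> \<lbrakk>x,z\<rbrakk>\<close>, which still needs all \<open>n\<close> factors \<open>x\<close> to vanish.\<close>

lemma brk_mul_funpow_zero:
  assumes "((\<lambda>y. x \<cdot> y) ^^ n) y = 0"
  shows "((\<lambda>y. x \<cdot> y) ^^ Suc n) \<lbrakk>y,z\<rbrakk> = 0"
  using assms
proof (induction n arbitrary: y)
  case 0
  then show ?case by (simp add: mul_simps brk_simps)
next
  case (Suc n)
  let ?L = "\<lambda>y. x \<cdot> y"
  interpret g: Vector_Spaces.linear scale scale "?L ^^ Suc n"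
    by (intro linear_funpow mul_linear_right)
  have pow: "(?L ^^ k) (y \<cdot> c) = (?L ^^ k) y \<cdot> c" for k c
    by (induction k) (simp_all add: mul_assoc)
  have "x \<cdot> \<lbrakk>y,z\<rbrakk> = \<lbrakk>x \<cdot> y,z\<rbrakk> - y \<cdot> \<lbrakk>x,z\<rbrakk>"
    by (simp add: leibniz mul_commute)
  moreover have "(?L ^^ Suc n) \<lbrakk>x \<cdot> y,z\<rbrakk> = 0"
    using Suc.prems by (intro Suc.IH) (simp add: funpow_swap1)
  moreover have "(?L ^^ Suc n) (y \<cdot> \<lbrakk>x,z\<rbrakk>) = 0"
    unfolding pow Suc.prems by (rule mul_simps)
  ultimately have "(?L ^^ Suc n) (x \<cdot> \<lbrakk>y,z\<rbrakk>) = 0" by (simp only: g.diff) simp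
  then show ?case by (simp add: funpow_swap1)
qed

lemma mul_nilpotent_if_ideal_in_frattini:
  assumes N: "is_ideal N" "N \<subseteq> frattini_subalgebra" and x: "x \<in> N"
  shows "\<exists>n. ((\<lambda>y. x \<cdot> y) ^^ n) v = 0"
proof -
  let ?L = "\<lambda>y. x \<cdot> y"
  have L: "Vector_Spaces.linear scale scale ?L" by (rule mul_linear_right)
  have "subalgebra (fitting_null ?L)"
    unfolding subalgebra_def
  proof (intro conjI ballI subspace_fitting_null L)
    fix y z assume "y \<in> fitting_null ?L"
    then obtain m where m: "(?L ^^ m) y = 0" by (auto simp: fitting_null_def)
    have "(?L ^^ k) (y \<cdot> z) = (?L ^^ k) y \<cdot> z" for k
      by (induction k) (simp_all add: mul_assoc)
    then have "(?L ^^ m) (y \<cdot> z) = 0" by (simp add: m mul_simps)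
    then show "y \<cdot> z \<in> fitting_null ?L" by (auto simp: fitting_null_def)
    show "\<lbrakk>y,z\<rbrakk> \<in> fitting_null ?L"
      using brk_mul_funpow_zero[OF m] unfolding fitting_null_def by blast
  qed
  moreover have "range ?L \<subseteq> N" using idealD(2)[OF N(1) x] by auto
  ultimately have "fitting_null ?L = UNIV" using frattini_fitting_null[OF L _ N(2)] by blast
  then show ?thesis by (auto simp: fitting_null_def)
qed

section \<open>Common annihilated vectors\<close>

text \<open>Choose a nonzero \<open>w \<in> N\<close> for which the subspace \<open>N \<cdot> w\<close> is minimal. If \<open>x \<cdot> w \<noteq> 0\<close> for some \<open>x \<in> N\<close>, then
  \<open>N \<cdot> (x \<cdot> w) = N \<cdot> w\<close> contains \<open>x \<cdot> w\<close>, so some \<open>y \<in> N\<close> fixes the nonzero vector \<open>x \<cdot> w\<close> and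
  does not act nilpotently.\<close>

lemma mul_nilpotent_annihilated_vector:
  assumes N: "is_ideal N" "N \<noteq> {0}" and nil: "\<And>x v. x \<in> N \<Longrightarrow> \<exists>n. ((\<lambda>y. x \<cdot> y) ^^ n) v = 0"
  obtains w where "w \<in> N" "w \<noteq> 0" "\<And>x. x \<in> N \<Longrightarrow> x \<cdot> w = 0"
proof -
  let ?P = "\<lambda>S. \<exists>w\<in>N - {0}. S = (\<lambda>x. x \<cdot> w) ` N"
  have "N - {0} \<noteq> {}" using N(2) subspace_0[OF idealD(1)[OF N(1)]] by auto
  then obtain w0 where "w0 \<in> N - {0}" by blast
  then have "?P ((\<lambda>x. x \<cdot> w0) ` N)" by blast
  moreover have "subspace S" if "?P S" for S
    using that linear_image_subspace[OF mul_linear_left idealD(1)[OF N(1)]] by blast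
  ultimately obtain S where S: "?P S" and min: "\<And>T. ?P T \<Longrightarrow> T \<subseteq> S \<Longrightarrow> T = S"
    by (rule minimal_subspace_exists[of ?P]) blast+
  then obtain w where w: "w \<in> N" "w \<noteq> 0" "S = (\<lambda>x. x \<cdot> w) ` N" by blast
  have "x \<cdot> w = 0" if x: "x \<in> N" for x
  proof (rule ccontr)
    assume ne: "x \<cdot> w \<noteq> 0"
    have "(\<lambda>y. y \<cdot> (x \<cdot> w)) ` N \<subseteq> S"
      unfolding w(3) using idealD(2)[OF N(1)] by (auto simp flip: mul_assoc)
    then have "(\<lambda>y. y \<cdot> (x \<cdot> w)) ` N = S"
      using min ne idealD(2)[OF N(1) x] by blast
    then obtain y where y: "y \<in> N" "x \<cdot> w = y \<cdot> (x \<cdot> w)" using x w(3) by blast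
    have "((\<lambda>z. y \<cdot> z) ^^ n) (x \<cdot> w) = x \<cdot> w" for n
      by (induction n) (use y in auto)
    then show False using nil[OF y(1), of "x \<cdot> w"] ne by simp
  qed
  with w show ?thesis using that by blast
qed

text \<open>Engel's theorem for the action of a Lie subalgebra \<open>K\<close> on the quotient of \<open>W\<close> by \<open>U\<close>,
  stated without forming the quotient. A maximal proper Lie subalgebra \<open>H\<close> of \<open>K\<close> is, by induction applied to
  its action on \<open>K\<close> modulo \<open>H\<close>, normalised by some \<open>z\<close> outside \<open>H\<close>, whence \<open>K = H + \<langle>z\<rangle>\<close>. By induction again,
  \<open>H\<close> sends some \<open>w \<in> W - U\<close> into \<open>U\<close>; so it does with every iterate of \<open>w\<close> under \<open>z\<close>, and the
  iterate just before the first one in \<open>U\<close> is the vector sought.\<close>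

lemma engel:
  assumes "subspace K" "\<And>x y. x \<in> K \<Longrightarrow> y \<in> K \<Longrightarrow> \<lbrakk>x,y\<rbrakk> \<in> K"
    and "\<And>x v. x \<in> K \<Longrightarrow> \<exists>n. ((\<lambda>y. \<lbrakk>x,y\<rbrakk>) ^^ n) v = 0"
    and "subspace U" "\<And>x u. x \<in> K \<Longrightarrow> u \<in> U \<Longrightarrow> \<lbrakk>x,u\<rbrakk> \<in> U"
    and "\<And>x w. x \<in> K \<Longrightarrow> w \<in> W \<Longrightarrow> \<lbrakk>x,w\<rbrakk> \<in> W"
    and "\<not> W \<subseteq> U"
  shows "\<exists>w\<in>W - U. \<forall>x\<in>K. \<lbrakk>x,w\<rbrakk> \<in> U"
  using assms
proof (induction "dim K" arbitrary: K U W rule: less_induct)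
  case less
  note K = less.prems(1,2) and nil = less.prems(3) and U = less.prems(4)
    and KU = less.prems(5) and KW = less.prems(6)
  show ?case
  proof (cases "K = {0}")
    case True
    then show ?thesis using less.prems(7) subspace_0[OF U] by (auto simp: brk_simps)
  next
    case False
    let ?P = "\<lambda>H. subspace H \<and> (\<forall>x\<in>H. \<forall>y\<in>H. \<lbrakk>x,y\<rbrakk> \<in> H) \<and> H \<subseteq> K \<and> H \<noteq> K"
    have "?P {0}" using False subspace_0[OF K(1)] by (auto simp: brk_simps)
    then obtain H where H: "?P H" and Hmax: "\<And>T. ?P T \<Longrightarrow> H \<subseteq> T \<Longrightarrow> T = H"
      by (rule maximal_subspace_exists[of ?P]) blast+
    have HK: "x \<in> K" if "x \<in> H" for x using that H by blast
    have "dim H < dim K"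
      using H dim_subset[of H K] subspace_dim_equal[of H K] K(1) by fastforce
    note IH = less.hyps[OF this]
    have "\<exists>z\<in>K - H. \<forall>x\<in>H. \<lbrakk>x,z\<rbrakk> \<in> H"
      by (rule IH) (use H K(2) HK nil in auto)
    then obtain z where z: "z \<in> K" "z \<notin> H" "\<And>x. x \<in> H \<Longrightarrow> \<lbrakk>x,z\<rbrakk> \<in> H" by blast
    have sH: "subspace H" using H by blast
    let ?T = "H \<oplus> span {z}"
    have HT: "H \<subseteq> ?T" and zT: "span {z} \<subseteq> ?T"
      using sum_superset[OF sH subspace_span] by blast+
    have "\<lbrakk>x,y\<rbrakk> \<in> H" if xy: "x \<in> ?T" "y \<in> ?T" for x y
    proof -
      obtain h c h' c' where e: "h \<in> H" "x = h + c *s z" "h' \<in> H" "y = h' + c' *s z"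
        using xy by (auto simp: span_singleton)
      have "\<lbrakk>z,h'\<rbrakk> = - \<lbrakk>h',z\<rbrakk>" by (rule brk_anticommute)
      then have "\<lbrakk>x,y\<rbrakk> = \<lbrakk>h,h'\<rbrakk> + c' *s \<lbrakk>h,z\<rbrakk> - c *s \<lbrakk>h',z\<rbrakk>"
        unfolding e by (simp add: brk_simps brk_alternating)
      moreover have "\<lbrakk>h,h'\<rbrakk> \<in> H" using H e by blast
      ultimately show ?thesis
        using e z(3) sH by (auto intro!: subspace_add subspace_diff subspace_scale)
    qed
    moreover have "?T \<subseteq> K"
      using HK z(1) K(1) by (intro sum_minimal span_minimal) auto
    moreover have "?T \<noteq> H" using zT z(2) span_base[of z "{z}"] by blast
    moreover have "subspace ?T" by (intro subspace_subspace_sum sH subspace_span)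
    ultimately have KT: "?T = K" using Hmax[of ?T] HT by blast
    have "\<exists>w\<in>W - U. \<forall>x\<in>H. \<lbrakk>x,w\<rbrakk> \<in> U"
      by (rule IH) (use H K(2) HK nil U KU KW less.prems(7) in auto)
    then obtain w where w: "w \<in> W" "w \<notin> U" "\<And>x. x \<in> H \<Longrightarrow> \<lbrakk>x,w\<rbrakk> \<in> U" by blast
    define f where "f n = ((\<lambda>y. \<lbrakk>z,y\<rbrakk>) ^^ n) w" for n
    have f: "f n \<in> W \<and> (\<forall>x\<in>H. \<lbrakk>x,f n\<rbrakk> \<in> U)" for n
    proof (induction n)
      case 0
      then show ?case using w by (simp add: f_def)
    next
      case (Suc n)
      have "\<lbrakk>x,\<lbrakk>z,f n\<rbrakk>\<rbrakk> \<in> U" if x: "x \<in> H" for x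
        unfolding brk_derivation[of x z]
        using Suc x z KU U by (auto intro!: subspace_add)
      then show ?case using Suc KW z(1) by (simp add: f_def)
    qed
    have "f 0 \<notin> U" using w by (simp add: f_def)
    moreover have "\<exists>n. f n \<in> U" using nil[OF z(1), of w] subspace_0[OF U] unfolding f_def by metis
    ultimately obtain n where n: "f (Suc n) \<in> U" "f n \<notin> U"
      using ex_least_nat_less[of "\<lambda>n. f n \<in> U"] by blast
    have "\<lbrakk>x,f n\<rbrakk> \<in> U" if x: "x \<in> K" for x
    proof -
      obtain h c where e: "x = h + c *s z" "h \<in> H"
        using x unfolding KT[symmetric] by (auto simp: span_singleton)
      have "\<lbrakk>z,f n\<rbrakk> \<in> U" using n(1) by (simp add: f_def)
      then show ?thesis
        unfolding e brk_simps using f e U by (auto intro!: subspace_add subspace_scale)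
    qed
    then show ?thesis using f n by blast
  qed
qed

section \<open>Minimal ideals inside the Frattini subalgebra\<close>

text \<open>The annihilator of \<open>N\<close> in \<open>N\<close>, for either product, is an ideal of the whole algebra and is nonzero by
  nilpotency, so it is all of the minimal ideal \<open>N\<close>. For the bracket this uses \<open>N \<cdot> N = 0\<close>.\<close>

lemma minimal_ideal_in_frattini_zero:
  assumes min: "minimal_ideal N" and F: "N \<subseteq> frattini_subalgebra"
  shows "zero_ideal N"
proof -
  note N = minimal_idealD(1,2)[OF min]
  note sN = idealD(1)[OF N(1)]
  let ?A = "{x \<in> N. \<forall>y\<in>N. x \<cdot> y = 0}"
  have "is_ideal ?A"
    unfolding is_ideal_def
  proof (intro conjI ballI allI)
    show "subspace ?A"
      using sN by (auto simp: subspace_def mul_simps)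
    fix x p assume x: "x \<in> ?A"
    have "(x \<cdot> p) \<cdot> y = 0" if "y \<in> N" for y
      using x idealD(3)[OF N(1) that] by (simp add: mul_assoc)
    then show "x \<cdot> p \<in> ?A" using x idealD(2)[OF N(1)] by auto
    have "\<lbrakk>x,p\<rbrakk> \<cdot> y = 0" if "y \<in> N" for y
      using leibniz[of x y p] x that idealD(4)[OF N(1) that, of p] by (simp add: brk_simps)
    then show "\<lbrakk>x,p\<rbrakk> \<in> ?A" using x idealD(4)[OF N(1)] by auto
  qed
  moreover obtain w where "w \<in> N" "w \<noteq> 0" "\<And>x. x \<in> N \<Longrightarrow> x \<cdot> w = 0"
    using mul_nilpotent_annihilated_vector[OF N] mul_nilpotent_if_ideal_in_frattini[OF N(1) F] by blast
  then have "w \<in> ?A" "w \<noteq> 0" by (auto simp: mul_commute[of w])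
  ultimately have "?A = N" using minimal_idealD(3)[OF min, of ?A] by blast
  then have mul0: "x \<cdot> y = 0" if "x \<in> N" "y \<in> N" for x y using that by blast
  let ?B = "{x \<in> N. \<forall>y\<in>N. \<lbrakk>y,x\<rbrakk> = 0}"
  have "is_ideal ?B"
    unfolding is_ideal_def
  proof (intro conjI ballI allI)
    show "subspace ?B"
      using sN by (auto simp: subspace_def brk_simps)
    fix x p assume x: "x \<in> ?B"
    have "\<lbrakk>y,x \<cdot> p\<rbrakk> = 0" if "y \<in> N" for y
      using x that idealD(4)[OF N(1) that, of p] by (simp add: brk_mul_derivation mul_simps mul0)
    then show "x \<cdot> p \<in> ?B" using x idealD(2)[OF N(1)] by auto
    have "\<lbrakk>y,\<lbrakk>x,p\<rbrakk>\<rbrakk> = 0" if "y \<in> N" for y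
    proof -
      have "\<lbrakk>x,\<lbrakk>y,p\<rbrakk>\<rbrakk> = - \<lbrakk>\<lbrakk>y,p\<rbrakk>,x\<rbrakk>" by (rule brk_anticommute)
      then show ?thesis
        using x that idealD(4)[OF N(1) that, of p] by (simp add: brk_derivation[of y] brk_simps)
    qed
    then show "\<lbrakk>x,p\<rbrakk> \<in> ?B" using x idealD(4)[OF N(1)] by auto
  qed
  moreover have "\<exists>w\<in>N - {0}. \<forall>x\<in>N. \<lbrakk>x,w\<rbrakk> \<in> {0}"
    using N subspace_0[OF sN] idealD(4)[OF N(1)]
    by (intro engel sN brk_nilpotent_if_ideal_in_frattini[OF N(1) F]) (auto simp: brk_simps)
  then have "?B \<noteq> {0}" by blast
  ultimately have "?B = N" using minimal_idealD(3)[OF min, of ?B] by blast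
  then have "\<lbrakk>x,y\<rbrakk> = 0" if "x \<in> N" "y \<in> N" for x y using that by blast
  with mul0 N show ?thesis by (simp add: zero_ideal_def)
qed

section \<open>Splitting over the zero socle\<close>

text \<open>Semisimplicity: an ideal \<open>B\<close> maximal among those in \<open>Zsoc\<close> meeting \<open>A\<close> trivially must, together
  with \<open>A\<close>, contain each minimal zero ideal \<open>I\<close>, as otherwise \<open>B \<oplus> I\<close> would be larger.\<close>

lemma Zsoc_complement:
  assumes A: "is_ideal A" "A \<subseteq> Zsoc"
  obtains B where "is_ideal B" "B \<subseteq> Zsoc" "A \<inter> B = {0}" "A \<oplus> B = Zsoc"
proof -
  let ?P = "\<lambda>B. is_ideal B \<and> B \<subseteq> Zsoc \<and> A \<inter> B = {0}"
  have "?P {0}"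
    using subspace_0[OF idealD(1)[OF A(1)]] subspace_0[OF idealD(1)[OF ideal_Zsoc]]
    by (auto simp: is_ideal_def mul_simps brk_simps)
  then obtain B where B: "?P B" and max: "\<And>T. ?P T \<Longrightarrow> B \<subseteq> T \<Longrightarrow> T = B"
    by (rule maximal_subspace_exists[of ?P]) (auto simp: is_ideal_def)
  have sB: "subspace B" using B idealD(1) by blast
  have AB: "is_ideal (A \<oplus> B)" using A B by (intro ideal_sum) auto
  have "I \<subseteq> A \<oplus> B" if I: "minimal_zero_ideal I" for I
  proof (rule ccontr)
    assume nsub: "\<not> I \<subseteq> A \<oplus> B"
    have mI: "minimal_ideal I" using I by (simp add: minimal_zero_ideal_def)
    note iI = minimal_idealD(1)[OF mI]
    have triv: "I \<inter> (A \<oplus> B) = {0}"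
      using minimal_idealD(3)[OF mI ideal_Int[OF iI AB]] nsub by blast
    have iBI: "is_ideal (B \<oplus> I)" using B iI by (intro ideal_sum) auto
    have "x = 0" if x: "x \<in> A" "x \<in> B \<oplus> I" for x
    proof -
      obtain b i where e: "x = b + i" "b \<in> B" "i \<in> I" using x(2) by blast
      have "i = x + (- b)" using e by simp
      moreover have "- b \<in> B" using e B by (auto intro: subspace_neg idealD)
      ultimately have "i \<in> A \<oplus> B" using x(1) by blast
      then have "i = 0" using triv e by blast
      then show ?thesis using e x B by auto
    qed
    then have "A \<inter> (B \<oplus> I) = {0}"
      using subspace_0[OF idealD(1)[OF A(1)]] subspace_0[OF idealD(1)[OF iBI]] by blast
    moreover have "B \<oplus> I \<subseteq> Zsoc"
      using B minimal_zero_ideal_subset_Zsoc[OF I] by (intro sum_minimal idealD(1)[OF ideal_Zsoc]) auto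
    ultimately have "B \<oplus> I = B"
      using iBI sum_superset(1)[OF sB idealD(1)[OF iI]] by (intro max conjI)
    with sum_superset(2)[OF sB idealD(1)[OF iI]] have "I \<subseteq> B" by (simp only:)
    with nsub sum_superset(2)[OF idealD(1)[OF A(1)] sB] show False by (meson subset_trans)
  qed
  then have "Zsoc \<subseteq> A \<oplus> B"
    unfolding Zsoc_def by (intro span_minimal idealD(1)[OF AB]) blast
  moreover have "A \<oplus> B \<subseteq> Zsoc"
    using A B by (intro sum_minimal idealD(1)[OF ideal_Zsoc]) auto
  ultimately have "A \<oplus> B = Zsoc" by (rule subset_antisym[rotated])
  then show ?thesis using B by (elim conjE) (rule that)
qed

text \<open>With \<open>Zsoc = A \<oplus> B\<close> and \<open>C\<close> a complement of \<open>Zsoc\<close>, the subalgebra \<open>B \<oplus> C\<close> is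
  a complement of \<open>A\<close>. It is maximal, since any strictly larger
  subalgebra meets \<open>A\<close> in a nonzero ideal, hence contains \<open>A\<close>.\<close>

lemma split_minimal_zero_ideal_avoids_maximal:
  assumes A: "minimal_zero_ideal A"
    and C: "subalgebra C" "Zsoc \<oplus> C = UNIV" "Zsoc \<inter> C = {0}"
  obtains M where "maximal_subalgebra M" "A \<inter> M = {0}"
proof -
  have mA: "minimal_ideal A" and zA: "zero_ideal A" using A by (auto simp: minimal_zero_ideal_def)
  note iA = minimal_idealD(1)[OF mA]
  note AZ = minimal_zero_ideal_subset_Zsoc[OF A]
  obtain B where B: "is_ideal B" "B \<subseteq> Zsoc" "A \<inter> B = {0}" "A \<oplus> B = Zsoc"
    by (rule Zsoc_complement[OF iA AZ])
  let ?M = "B \<oplus> C"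
  have sM: "subalgebra ?M" using B C by (intro subalgebra_ideal_sum)
  have "v \<in> A \<oplus> ?M" for v
  proof -
    obtain z c where z: "v = z + c" "z \<in> Zsoc" "c \<in> C" using C(2) by (rule sum_UNIV_E)
    obtain a b where a: "z = a + b" "a \<in> A" "b \<in> B" using z(2) B(4) by blast
    have "v = a + (b + c)" using z a by (simp add: add.assoc)
    then show ?thesis using a z by blast
  qed
  then have sum: "A \<oplus> ?M = UNIV" by blast
  have "x = 0" if x: "x \<in> A" "x \<in> ?M" for x
  proof -
    obtain b c where e: "x = b + c" "b \<in> B" "c \<in> C" using x(2) by blast
    have "c = x - b" using e by simp
    moreover have "x \<in> Zsoc" "b \<in> Zsoc" using x(1) e(2) AZ B(2) by blast+
    ultimately have "c \<in> Zsoc" using subspace_diff[OF idealD(1)[OF ideal_Zsoc]] by simp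
    then have "c = 0" using e C(3) by blast
    then show ?thesis using e x B(3) by auto
  qed
  then have triv: "A \<inter> ?M = {0}"
    using subspace_0[OF idealD(1)[OF iA]] subspace_0[OF subalgebraD(1)[OF sM]] by blast
  have "S = ?M" if S: "subalgebra S" "S \<noteq> UNIV" "?M \<subseteq> S" for S
  proof -
    have "v \<in> A \<oplus> S" for v
      by (rule sum_UNIV_E[OF sum, of v]) (use S(3) in blast)
    then have sumS: "A \<oplus> S = UNIV" by blast
    have "A \<inter> S \<noteq> A"
    proof
      assume "A \<inter> S = A"
      then have "A \<oplus> S \<subseteq> S" by (intro sum_minimal subalgebraD(1)[OF S(1)]) auto
      then have "UNIV \<subseteq> S" unfolding sumS .
      with S(2) show False by blast
    qed
    then have AS: "A \<inter> S = {0}"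
      using minimal_idealD(3)[OF mA ideal_zero_ideal_Int_supplement[OF zA S(1) sumS]] by blast
    have "s \<in> ?M" if s: "s \<in> S" for s
    proof -
      obtain a m where e: "s = a + m" "a \<in> A" "m \<in> ?M" using sum by (rule sum_UNIV_E)
      have "a = s - m" using e by simp
      moreover have "m \<in> S" using S(3) e(3) by (rule subsetD)
      ultimately have "a \<in> S" using subspace_diff[OF subalgebraD(1)[OF S(1)] s] by simp
      then have "a = 0" using AS e by blast
      then show ?thesis using e by simp
    qed
    then have "S \<subseteq> ?M" by (rule subsetI)
    then show ?thesis using S(3) by (rule subset_antisym)
  qed
  moreover have "?M \<noteq> UNIV"
  proof
    assume "?M = UNIV"
    with triv have "A = {0}" by (simp only: Int_UNIV_right)
    with minimal_idealD(2)[OF mA] show False ..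
  qed
  ultimately have "maximal_subalgebra ?M"
    using sM unfolding maximal_subalgebra_def by (intro conjI allI impI) simp_all
  then show ?thesis using triv by (rule that)
qed

lemma phi_free_if_Zsoc_splits:
  assumes C: "subalgebra C" "Zsoc \<oplus> C = UNIV" "Zsoc \<inter> C = {0}"
  shows phi_free
proof (rule ccontr)
  assume "\<not> phi_free"
  let ?P = "\<lambda>I. is_ideal I \<and> I \<noteq> {0} \<and> I \<subseteq> frattini_ideal"
  have "?P frattini_ideal" using \<open>\<not> phi_free\<close> is_ideal_frattini_ideal by (simp add: phi_free_def)
  then obtain N where N: "?P N" and min: "\<And>T. ?P T \<Longrightarrow> T \<subseteq> N \<Longrightarrow> T = N"
    by (rule minimal_subspace_exists[of ?P]) (auto simp: is_ideal_def)
  have mN: "minimal_ideal N" unfolding minimal_ideal_def using N min by blast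
  have F: "N \<subseteq> frattini_subalgebra" using N frattini_ideal_subset by blast
  have "minimal_zero_ideal N"
    using mN minimal_ideal_in_frattini_zero[OF mN F] by (simp add: minimal_zero_ideal_def)
  then obtain M where M: "maximal_subalgebra M" "N \<inter> M = {0}"
    by (rule split_minimal_zero_ideal_avoids_maximal[OF _ C])
  then have "N \<subseteq> M" using F by (auto simp: frattini_subalgebra_def)
  with M N show False by auto
qed

theorem phi_free_iff_Zsoc_splits:
  "phi_free \<longleftrightarrow> (\<exists>C. subalgebra C \<and> Zsoc \<oplus> C = UNIV \<and> Zsoc \<inter> C = {0})"
proof
  assume phi_free
  then obtain C where "subalgebra C" "Zsoc \<oplus> C = UNIV" "Zsoc \<inter> C = {0}"
    by (rule phi_free_splits_over_zero_ideal[OF _ zero_ideal_Zsoc])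
  then show "\<exists>C. subalgebra C \<and> Zsoc \<oplus> C = UNIV \<and> Zsoc \<inter> C = {0}"
    by (intro exI conjI)
next
  assume "\<exists>C. subalgebra C \<and> Zsoc \<oplus> C = UNIV \<and> Zsoc \<inter> C = {0}"
  then show phi_free by (elim exE conjE) (rule phi_free_if_Zsoc_splits)
qed

end

theorem theorem4p3:
  fixes scale :: "'f::field \<Rightarrow> 'v::ab_group_add \<Rightarrow> 'v"
    and mul brk :: "'v \<Rightarrow> 'v \<Rightarrow> 'v"
  assumes "poisson_algebra scale mul brk"
    and "\<exists>B. finite_dimensional_vector_space scale B"
  shows "poisson_algebra.phi_free scale mul brk \<longleftrightarrow>
    (\<exists>C. poisson_algebra.subalgebra scale mul brk C \<and>
         {z + c | z c. z \<in> poisson_algebra.Zsoc scale mul brk \<and> c \<in> C} = UNIV \<and>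
         poisson_algebra.Zsoc scale mul brk \<inter> C = {0})"
proof -
  obtain Basis where "finite_dimensional_vector_space scale Basis" using assms(2) by blast
  then interpret finite_dimensional_poisson_algebra scale mul brk Basis
    using assms(1) by (simp add: finite_dimensional_poisson_algebra_def)
  show ?thesis using phi_free_iff_Zsoc_splits unfolding subspace_sum_def .
qed

end
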